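(* Let $(X,d)$ be a Polish metric space. Then the $\infty$-Wasserstein space $(\mathcal P_\infty(X),W_\infty)$ is Gromov-compactifiable if and only if $(X,d)$ is Gromov-compactifiable.
   Context: A Polish metric space is a complete separable metric space. Gromov-compactifiability: for a (nonempty) metric space $(Y,\varrho)$ and a base point $y_0\in Y$, the horofunction map is $h_{y_0}\colon Y\to\mathbb R^Y$, $h_{y_0}(z)(y):=\varrho(y,z)-\varrho(y_0,z)$, where $\mathbb R^Y$ carries the topology of pointwise convergence. The map $h_{y_0}$ is continuous and injective. $(Y,\varrho)$ is called Gromov-compactifiable if $h_{y_0}$ is a topological embedding (a homeomorphism onto its image); this does not depend on the choice of $y_0$. $\infty$-Wasserstein space: $\mathcal P_\infty(X)$ is the set of Borel probability measures on $X$ with bounded support. For $\mu,\nu\in\mathcal P_\infty(X)$, $\Pi(\mu,\nu)$ is the set of Borel probability measures on $X\times X$ with first marginal $\mu$ and second marginal $\nu$; $\|\pi\|_\infty$ denotes the essential supremum of $(x,y)\mapsto d(x,y)$ with respect to $\pi$, and $W_\infty(\mu,\nu):=\inf_{\pi\in\Pi(\mu,\nu)}\|\pi\|_\infty$. *)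

theory Defs
  imports "HOL-Probability.Probability"
begin

context Metric_space
begin

definition pointwise_topology :: "('a \<Rightarrow> real) topology"
  where "pointwise_topology = product_topology (\<lambda>_. euclideanreal) M"

definition horofunction :: "'a \<Rightarrow> 'a \<Rightarrow> 'a \<Rightarrow> real"
  where "horofunction y0 z = (\<lambda>y\<in>M. d y z - d y0 z)"

text \<open>Some base point is required to work; by \<open>embedding_horofunction_base_point\<close> below, any
  other one then works as well. The empty space is not Gromov-compactifiable.\<close>

definition gromov_compactifiable :: bool
  where "gromov_compactifiable \<longleftrightarrow>
    (\<exists>y0\<in>M. embedding_map mtopology pointwise_topology (horofunction y0))"

lemma embedding_horofunction_base_point:
  assumes y0: "y0 \<in> M" and y1: "y1 \<in> M"
    and emb: "embedding_map mtopology pointwise_topology (horofunction y0)"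
  shows "embedding_map mtopology pointwise_topology (horofunction y1)"
proof -
  let ?P = "pointwise_topology"
  define T where "T = (\<lambda>a (f :: 'a \<Rightarrow> real). \<lambda>y\<in>M. f y - f a)"
  have contT: "continuous_map ?P ?P (T a)" if "a \<in> M" for a
    unfolding pointwise_topology_def continuous_map_componentwise T_def
    using that by (auto intro!: continuous_map_diff continuous_map_product_projection)
  have T1: "T y1 (horofunction y0 z) = horofunction y1 z" for z
    using y1 by (auto simp: T_def horofunction_def fun_eq_iff)
  have T0: "T y0 (horofunction y1 z) = horofunction y0 z" for z
    using y0 by (auto simp: T_def horofunction_def fun_eq_iff)
  obtain k where k: "homeomorphic_maps mtopology (subtopology ?P (horofunction y0 ` M)) (horofunction y0) k"
    using emb by (auto simp: embedding_map_def homeomorphic_map_maps)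
  have c0: "continuous_map mtopology ?P (horofunction y0)"
    using k by (auto simp: homeomorphic_maps_def continuous_map_in_subtopology)
  have c1: "continuous_map mtopology ?P (horofunction y1)"
    using continuous_map_compose[OF c0 contT[OF y1]] T1 by (simp add: o_def)
  have "continuous_map (subtopology ?P (horofunction y1 ` M)) (subtopology ?P (horofunction y0 ` M)) (T y0)"
    unfolding continuous_map_in_subtopology
    using T0 by (auto intro: continuous_map_from_subtopology[OF contT[OF y0]])
  then have "continuous_map (subtopology ?P (horofunction y1 ` M)) mtopology (k \<circ> T y0)"
    using k by (auto simp: homeomorphic_maps_def intro: continuous_map_compose)
  then have "homeomorphic_maps mtopology (subtopology ?P (horofunction y1 ` M)) (horofunction y1) (k \<circ> T y0)"
    using c1 k T0 by (auto simp: homeomorphic_maps_def continuous_map_in_subtopology)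
  then show ?thesis
    by (auto simp: embedding_map_def homeomorphic_map_maps)
qed

end

definition measure_support :: "'a::topological_space measure \<Rightarrow> 'a set"
  where "measure_support \<mu> = {x. \<forall>U. open U \<longrightarrow> x \<in> U \<longrightarrow> emeasure \<mu> U > 0}"

definition P_infinity :: "'a::polish_space measure set"
  where "P_infinity = {\<mu>. prob_space \<mu> \<and> sets \<mu> = sets borel \<and> bounded (measure_support \<mu>)}"

definition couplings :: "'a::polish_space measure \<Rightarrow> 'a measure \<Rightarrow> ('a \<times> 'a) measure set"
  where "couplings \<mu> \<nu> = {\<pi>. prob_space \<pi> \<and> sets \<pi> = sets borel \<and>
    distr \<pi> borel fst = \<mu> \<and> distr \<pi> borel snd = \<nu>}"

definition coupling_norm :: "('a::polish_space \<times> 'a) measure \<Rightarrow> ereal"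
  where "coupling_norm \<pi> = esssup \<pi> (\<lambda>(x, y). ereal (dist x y))"

text \<open>For \<open>\<mu>\<close> and \<open>\<nu>\<close> in \<open>P_infinity\<close> the infimum is finite, since the product coupling is
  concentrated on a bounded set, so the conversion to \<open>real\<close> loses nothing.\<close>

definition W_infinity :: "'a::polish_space measure \<Rightarrow> 'a measure \<Rightarrow> real"
  where "W_infinity \<mu> \<nu> = real_of_ereal (INF \<pi>\<in>couplings \<mu> \<nu>. coupling_norm \<pi>)"

end

(* A metric space is Gromov-compactifiable iff around every z0 the triangle inequality through z0 has a
   uniform gap: for each eps > 0 there are finitely many y and a delta > 0 such that every z with
   d(z0,z) >= eps satisfies d(y,z) + delta <= d(y,z0) + d(z0,z) for one of the y.

   From the Wasserstein space to X: apply the gap at the Dirac measure of z0 and replace each of the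
   finitely many measures by an almost farthest point of its support from z0.

   From X to the Wasserstein space: fix one point x in the support of mu and take the points y of the
   gap at x. For each y choose radii s < t slightly below d(y,x) such that the annulus between them
   has small mu-mass, and let rho_y arise from mu by moving to y everything within distance s of y
   together with a bit of the mass near x that outweighs the annulus. Then W(rho_y,mu) >= t, because
   the atom at y is heavier than the t-ball around y. Given nu, by the pigeonhole principle a fixed
   fraction of the mass near x is transported to points for which one of the y has a gap, and for
   that y we get W(rho_y,nu) <= s + W(mu,nu), up to arbitrarily small errors: a gain of t - s. *)
theory Submission
  imports Defs
begin

section \<open>A metric criterion for Gromov-compactifiability\<close>

context Metric_space
begin

text \<open>Comparing the values at z and at w expresses \<open>d z w\<close> once as
  \<open>d y0 w - d y0 z\<close> and once as its negative.\<close>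

lemma inj_on_horofunction:
  assumes "y0 \<in> M"
  shows "inj_on (horofunction y0) M"
proof (rule inj_onI)
  fix z w assume z: "z \<in> M" and w: "w \<in> M" and eq: "horofunction y0 z = horofunction y0 w"
  have e: "d y z - d y0 z = d y w - d y0 w" if "y \<in> M" for y
    using fun_cong[OF eq, of y] that by (simp add: horofunction_def)
  have "d z w = 0"
    using e[OF z] e[OF w] mdist_zero[OF z] mdist_zero[OF w] commute[of z w] by linarith
  then show "z = w" using z w by simp
qed

lemma continuous_map_horofunction:
  assumes "y0 \<in> M"
  shows "continuous_map mtopology pointwise_topology (horofunction y0)"
proof -
  have c: "continuous_map mtopology euclideanreal (\<lambda>z. d y z)" if "y \<in> M" for y
    using continuous_map_mdist[of mtopology "metric (M, d)" "\<lambda>_. y" "\<lambda>z. z"] that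
    by (simp add: mtopology_of_def)
  show ?thesis
    unfolding pointwise_topology_def continuous_map_componentwise horofunction_def
    using assms by (intro conjI ballI) (auto simp: extensional_def intro!: continuous_map_diff c)
qed

text \<open>With base point z0, coordinate y of the horofunction of z is
  \<open>d y z - d z0 z\<close>, which never exceeds the value \<open>d y z0\<close> taken at z0. A
  basic neighbourhood inside the open image of the \<epsilon>-ball can therefore be left only
  downwards, and only in one of finitely many coordinates.\<close>

lemma gromov_compactifiable_imp_gap:
  assumes gc: gromov_compactifiable and z0: "z0 \<in> M" and e: "\<epsilon> > 0"
  shows "\<exists>F \<delta>. finite F \<and> F \<subseteq> M \<and> \<delta> > 0 \<and>
    (\<forall>z\<in>M. \<epsilon> \<le> d z0 z \<longrightarrow> (\<exists>y\<in>F. d y z + \<delta> \<le> d y z0 + d z0 z))"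
proof -
  let ?P = pointwise_topology and ?h = "horofunction z0"
  have "embedding_map mtopology ?P ?h"
    using gc z0 embedding_horofunction_base_point unfolding gromov_compactifiable_def by blast
  then have hom: "homeomorphic_map mtopology (subtopology ?P (?h ` M)) ?h"
    by (simp add: embedding_map_def)
  have "openin (subtopology ?P (?h ` M)) (?h ` mball z0 \<epsilon>)"
    using homeomorphic_imp_open_map[OF hom] by (simp add: open_map_def)
  then obtain V where V: "openin ?P V" "?h ` mball z0 \<epsilon> = V \<inter> ?h ` M"
    by (auto simp: openin_subtopology)
  have "?h z0 \<in> V" using V(2) z0 e by auto
  then have "\<exists>U. finite {i \<in> M. U i \<noteq> topspace euclideanreal} \<and> (\<forall>i\<in>M. openin euclideanreal (U i)) \<and>
      ?h z0 \<in> Pi\<^sub>E M U \<and> Pi\<^sub>E M U \<subseteq> V"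
    by (rule bspec[OF V(1)[unfolded pointwise_topology_def openin_product_topology_alt]])
  then obtain U where U': "finite {i \<in> M. U i \<noteq> topspace euclideanreal} \<and>
      (\<forall>i\<in>M. openin euclideanreal (U i)) \<and> ?h z0 \<in> Pi\<^sub>E M U \<and> Pi\<^sub>E M U \<subseteq> V"
    by (rule exE)
  have fin: "finite {i \<in> M. U i \<noteq> UNIV}" and U: "\<And>i. i \<in> M \<Longrightarrow> open (U i)"
    and hU: "?h z0 \<in> Pi\<^sub>E M U" and UV: "Pi\<^sub>E M U \<subseteq> V"
    using U' by simp_all
  define F where "F = {i \<in> M. U i \<noteq> UNIV}"
  have "\<exists>r>0. \<forall>t. \<bar>t - ?h z0 i\<bar> < r \<longrightarrow> t \<in> U i" if "i \<in> M" for i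
    using U[OF that] hU that unfolding open_dist by (auto simp: dist_real_def PiE_iff)
  then obtain r where r: "\<And>i. i \<in> M \<Longrightarrow> r i > 0"
    "\<And>i t. i \<in> M \<Longrightarrow> \<bar>t - ?h z0 i\<bar> < r i \<Longrightarrow> t \<in> U i" by metis
  \<comment> \<open>The 1 keeps the minimum meaningful when F is empty.\<close>
  define \<delta> where "\<delta> = Min (insert 1 (r ` F))"
  have finF: "finite F" using fin by (simp add: F_def)
  have FM: "F \<subseteq> M" by (auto simp: F_def)
  have \<delta>: "\<delta> > 0" "\<And>i. i \<in> F \<Longrightarrow> \<delta> \<le> r i"
    using finF FM r(1) by (auto simp: \<delta>_def)
  have "\<exists>y\<in>F. d y z + \<delta> \<le> d y z0 + d z0 z" if z: "z \<in> M" "\<epsilon> \<le> d z0 z" for z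
  proof (rule ccontr)
    assume n: "\<not> ?thesis"
    have "?h z i \<in> U i" if "i \<in> M" for i
    proof (cases "i \<in> F")
      case True
      then have "d i z + \<delta> > d i z0 + d z0 z" using n by auto
      moreover have "d i z \<le> d i z0 + d z0 z" using triangle that z z0 by auto
      ultimately have "\<bar>?h z i - ?h z0 i\<bar> < r i"
        using that z0 \<delta>(2)[OF True] by (simp add: horofunction_def)
      then show ?thesis using r(2) that by blast
    qed (use that in \<open>auto simp: F_def\<close>)
    then have "?h z \<in> V" using UV by (auto simp: PiE_iff horofunction_def)
    then have "?h z \<in> ?h ` mball z0 \<epsilon>" using V(2) z by auto
    then have "z \<in> mball z0 \<epsilon>"
      using inj_on_horofunction[OF z0] z by (auto dest: inj_onD)
    then show False using z by auto
  qed
  then show ?thesis using finF FM \<delta>(1) by blast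
qed

text \<open>It remains to see that the horofunction map is open onto its image; the gap at z0 gives
  a neighbourhood of the image of z0 which no point at distance \<epsilon> or more can
  enter.\<close>

lemma gap_imp_gromov_compactifiable:
  assumes ne: "M \<noteq> {}"
    and gap: "\<And>z0 \<epsilon>. z0 \<in> M \<Longrightarrow> \<epsilon> > 0 \<Longrightarrow> \<exists>F \<delta>. finite F \<and> F \<subseteq> M \<and> \<delta> > 0 \<and>
      (\<forall>z\<in>M. \<epsilon> \<le> d z0 z \<longrightarrow> (\<exists>y\<in>F. d y z + \<delta> \<le> d y z0 + d z0 z))"
  shows gromov_compactifiable
proof -
  obtain y0 where y0: "y0 \<in> M" using ne by blast
  let ?P = pointwise_topology and ?h = "horofunction y0"
  have "openin (subtopology ?P (?h ` M)) (?h ` W)" if W: "openin mtopology W" for W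
  proof (subst openin_subopen, intro ballI)
    fix f assume "f \<in> ?h ` W"
    then obtain z0 where z0: "z0 \<in> W" "f = ?h z0" by blast
    then have z0M: "z0 \<in> M" using W by (auto simp: openin_mtopology)
    obtain \<epsilon> where e: "\<epsilon> > 0" "mball z0 \<epsilon> \<subseteq> W" using W z0 by (auto simp: openin_mtopology)
    obtain F \<delta> where F: "finite F" "F \<subseteq> M" "\<delta> > 0"
      "\<And>z. z \<in> M \<Longrightarrow> \<epsilon> \<le> d z0 z \<Longrightarrow> \<exists>y\<in>F. d y z + \<delta> \<le> d y z0 + d z0 z"
      using gap[OF z0M e(1)] by blast
    \<comment> \<open>Differences of two coordinates do not see the base point: at the horofunction
      of z they equal \<open>d y z - d z0 z\<close>. So y0 can stay fixed while z0 varies. The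
      intersection with the whole space matters when F is empty.\<close>
    define V where "V = (\<Inter>y\<in>F. {g \<in> topspace ?P. g y - g z0 \<in> {d y z0 - \<delta><..}}) \<inter> topspace ?P"
    have "openin ?P {g \<in> topspace ?P. g y - g z0 \<in> {d y z0 - \<delta><..}}" if "y \<in> F" for y
    proof (rule openin_continuous_map_preimage)
      show "continuous_map ?P euclideanreal (\<lambda>g. g y - g z0)"
        unfolding pointwise_topology_def using that F(2) z0M
        by (auto intro!: continuous_map_diff continuous_map_product_projection)
    qed auto
    then have V: "openin ?P V"
      unfolding V_def using F(1) by (cases "F = {}") (auto intro!: openin_Int openin_Inter)
    have hP: "?h z \<in> topspace ?P" for z
      by (auto simp: pointwise_topology_def horofunction_def)
    have "?h z \<in> ?h ` W" if z: "z \<in> M" "?h z \<in> V" for z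
    proof -
      have "d y z0 + d z0 z < d y z + \<delta>" if "y \<in> F" for y
      proof -
        have "y \<in> M" using that F(2) by blast
        moreover have "d y z0 - \<delta> < ?h z y - ?h z z0" using z(2) that unfolding V_def by blast
        ultimately show ?thesis using z0M by (simp add: horofunction_def)
      qed
      then have "d z0 z < \<epsilon>" using F(4)[OF z(1)] by force
      then show ?thesis using e z z0M by auto
    qed
    then have "V \<inter> ?h ` M \<subseteq> ?h ` W" by auto
    moreover have "f \<in> V \<inter> ?h ` M"
      using hP z0 z0M F y0 by (auto simp: V_def horofunction_def)
    ultimately show "\<exists>T. openin (subtopology ?P (?h ` M)) T \<and> f \<in> T \<and> T \<subseteq> ?h ` W"
      using V by (auto simp: openin_subtopology)
  qed
  then have op: "open_map mtopology (subtopology ?P (?h ` M)) ?h"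
    by (auto simp: open_map_def)
  have "homeomorphic_map mtopology (subtopology ?P (?h ` M)) ?h"
  proof (rule bijective_open_imp_homeomorphic_map[OF _ op])
    show "continuous_map mtopology (subtopology ?P (?h ` M)) ?h"
      using continuous_map_horofunction[OF y0] by (auto simp: continuous_map_in_subtopology)
    show "?h ` topspace mtopology = topspace (subtopology ?P (?h ` M))"
      by (auto simp: pointwise_topology_def horofunction_def)
    show "inj_on ?h (topspace mtopology)" using inj_on_horofunction[OF y0] by simp
  qed
  then show ?thesis using y0 unfolding gromov_compactifiable_def embedding_map_def by auto
qed

end

section \<open>Couplings of bounded displacement\<close>

text \<open>A real-valued substitute for the infimum over couplings, whose attainment is left open:
  it bounds \<open>W_infinity\<close> by r and follows from a strict bound.\<close>

definition W_le :: "'a::polish_space measure \<Rightarrow> 'a measure \<Rightarrow> real \<Rightarrow> bool"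
  where "W_le \<mu> \<nu> r \<longleftrightarrow> (\<exists>\<pi>\<in>couplings \<mu> \<nu>. AE p in \<pi>. dist (fst p) (snd p) \<le> r)"

lemma couplingsD:
  assumes "\<pi> \<in> couplings \<mu> \<nu>"
  shows "prob_space \<pi>" "sets \<pi> = sets borel" "space \<pi> = UNIV"
    "distr \<pi> borel fst = \<mu>" "distr \<pi> borel snd = \<nu>"
    "fst \<in> \<pi> \<rightarrow>\<^sub>M borel" "snd \<in> \<pi> \<rightarrow>\<^sub>M borel"
  using assms unfolding couplings_def
  by (auto dest: sets_eq_imp_space_eq simp: measurable_cong_sets[of \<pi> borel borel borel]
      intro!: borel_measurable_continuous_onI continuous_intros)

lemma P_infinityD:
  assumes "\<mu> \<in> P_infinity"
  shows "prob_space \<mu>" "sets \<mu> = sets borel" "space \<mu> = UNIV"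
  using assms unfolding P_infinity_def by (auto dest: sets_eq_imp_space_eq)

text \<open>By the Lindelof property the union of all open null sets is a union of countably many of
  them, hence null.\<close>

lemma AE_measure_support:
  fixes \<mu> :: "'a::polish_space measure"
  assumes s: "sets \<mu> = sets borel"
  shows "AE x in \<mu>. x \<in> measure_support \<mu>"
proof -
  define N where "N = {U. open U \<and> emeasure \<mu> U = 0}"
  obtain N' where N': "N' \<subseteq> N" "countable N'" "\<Union>N' = \<Union>N"
    using Lindelof[of N] by (auto simp: N_def)
  have "(\<Union>U\<in>N'. U) \<in> null_sets \<mu>"
    using N' by (intro null_sets_UN') (auto simp: N_def null_sets_def s)
  then have "AE x in \<mu>. x \<notin> \<Union>N" using N'(3) by (auto dest: AE_not_in)
  then show ?thesis
    by (rule eventually_mono) (auto simp: measure_support_def N_def zero_less_iff_neq_zero)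
qed

text \<open>The complement of a closed ball of full measure is an open null set and so misses the
  support; conversely the support itself has full measure.\<close>

lemma P_infinity_iff:
  fixes \<mu> :: "'a::polish_space measure"
  shows "\<mu> \<in> P_infinity \<longleftrightarrow> prob_space \<mu> \<and> sets \<mu> = sets borel \<and> (\<exists>x R. AE y in \<mu>. dist x y \<le> R)"
proof (cases "prob_space \<mu> \<and> sets \<mu> = sets borel")
  case True
  have "bounded (measure_support \<mu>)" if "AE y in \<mu>. dist x y \<le> R" for x R
  proof -
    have o: "open {y. R < dist x y}" by (intro open_Collect_less continuous_intros)
    then have "{y. R < dist x y} \<in> sets \<mu>" using True by simp
    moreover have "AE y in \<mu>. y \<notin> {y. R < dist x y}" using that by (simp add: not_less)
    ultimately have "emeasure \<mu> {y. R < dist x y} = 0" by (simp add: AE_iff_null_sets null_setsD1)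
    then have "measure_support \<mu> \<subseteq> cball x R"
      using o by (fastforce simp: measure_support_def not_less[symmetric])
    then show ?thesis using bounded_cball bounded_subset by blast
  qed
  moreover have "\<exists>x R. AE y in \<mu>. dist x y \<le> R" if bd: "bounded (measure_support \<mu>)"
  proof -
    obtain x R where "\<forall>y\<in>measure_support \<mu>. dist x y \<le> R"
      using bd unfolding bounded_def by blast
    then have "AE y in \<mu>. dist x y \<le> R"
      using eventually_mono[OF AE_measure_support[of \<mu>]] True by auto
    then show ?thesis by blast
  qed
  ultimately show ?thesis using True by (auto simp: P_infinity_def)
qed (auto simp: P_infinity_def)

lemma coupling_norm_le_iff:
  assumes "\<pi> \<in> couplings \<mu> \<nu>"
  shows "coupling_norm \<pi> \<le> ereal r \<longleftrightarrow> (AE p in \<pi>. dist (fst p) (snd p) \<le> r)"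
proof -
  have m: "(\<lambda>(x, y). ereal (dist x y)) \<in> borel_measurable \<pi>"
    using couplingsD(6,7)[OF assms] by (simp add: split_beta)
  have "AE p in \<pi>. ereal (dist (fst p) (snd p)) \<le> coupling_norm \<pi>"
    using esssup_AE[of "\<lambda>(x, y). ereal (dist x y)" \<pi>] by (simp add: coupling_norm_def split_beta)
  then have "coupling_norm \<pi> \<le> ereal r \<Longrightarrow> AE p in \<pi>. dist (fst p) (snd p) \<le> r"
    by (elim eventually_mono) (metis ereal_less_eq(3) order_trans)
  moreover have "coupling_norm \<pi> \<le> ereal r" if "AE p in \<pi>. dist (fst p) (snd p) \<le> r"
    unfolding coupling_norm_def by (rule esssup_I[OF m]) (use that in \<open>simp add: split_beta\<close>)
  ultimately show ?thesis by blast
qed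

lemma coupling_norm_nonneg:
  assumes "\<pi> \<in> couplings \<mu> \<nu>"
  shows "0 \<le> coupling_norm \<pi>"
proof (rule ccontr)
  assume "\<not> ?thesis"
  then have "coupling_norm \<pi> < 0" by simp
  then obtain r where r: "coupling_norm \<pi> < ereal r" "ereal r < 0" using ereal_dense2 by blast
  then have "AE p in \<pi>. dist (fst p) (snd p) \<le> r"
    using coupling_norm_le_iff[OF assms, of r] less_imp_le by blast
  then have "AE p in \<pi>. False"
    by (rule eventually_mono) (use r(2) in \<open>auto dest: order_trans[OF zero_le_dist]\<close>)
  then show False using prob_space.AE_False[OF couplingsD(1)[OF assms]] by simp
qed

text \<open>The infimum lies between 0 and r, so it is finite and \<open>real_of_ereal\<close>
  preserves the comparison.\<close>

lemma W_le_imp_W_infinity_le: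
  assumes "W_le \<mu> \<nu> r"
  shows "W_infinity \<mu> \<nu> \<le> r" "0 \<le> W_infinity \<mu> \<nu>"
proof -
  let ?I = "INF \<pi>\<in>couplings \<mu> \<nu>. coupling_norm \<pi>"
  obtain \<pi> where "\<pi> \<in> couplings \<mu> \<nu>" "coupling_norm \<pi> \<le> ereal r"
    using assms coupling_norm_le_iff unfolding W_le_def by blast
  then have 1: "?I \<le> ereal r" by (meson INF_lower2)
  have 2: "0 \<le> ?I" using coupling_norm_nonneg by (auto intro: INF_greatest)
  show "W_infinity \<mu> \<nu> \<le> r" "0 \<le> W_infinity \<mu> \<nu>"
    unfolding W_infinity_def using 1 2 by (cases ?I; auto)+
qed

text \<open>The bound with R rules out an infinite infimum, which \<open>real_of_ereal\<close> would
  turn into 0.\<close>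

lemma W_infinity_less_imp_W_le:
  assumes ex: "W_le \<mu> \<nu> R" and r: "W_infinity \<mu> \<nu> < r"
  shows "W_le \<mu> \<nu> r"
proof -
  let ?I = "INF \<pi>\<in>couplings \<mu> \<nu>. coupling_norm \<pi>"
  obtain \<pi> where "\<pi> \<in> couplings \<mu> \<nu>" "coupling_norm \<pi> \<le> ereal R"
    using ex coupling_norm_le_iff unfolding W_le_def by blast
  then have 1: "?I \<le> ereal R" by (meson INF_lower2)
  have 2: "0 \<le> ?I" using coupling_norm_nonneg by (auto intro: INF_greatest)
  have "?I < ereal r" using r 1 2 unfolding W_infinity_def by (cases ?I; auto)
  then obtain \<pi> where "\<pi> \<in> couplings \<mu> \<nu>" "coupling_norm \<pi> < ereal r"
    by (auto simp: INF_less_iff)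
  then show ?thesis using coupling_norm_le_iff less_imp_le unfolding W_le_def by blast
qed

text \<open>Every coupling constructed below arises in this way, as the joint law of two maps on one
  probability space.\<close>

lemma W_leI:
  fixes f g :: "'b \<Rightarrow> 'a::polish_space"
  assumes P: "prob_space P" and f[measurable]: "f \<in> P \<rightarrow>\<^sub>M borel" and g[measurable]: "g \<in> P \<rightarrow>\<^sub>M borel"
    and AE: "AE \<omega> in P. dist (f \<omega>) (g \<omega>) \<le> r"
  shows "W_le (distr P borel f) (distr P borel g) r"
proof -
  let ?h = "\<lambda>\<omega>. (f \<omega>, g \<omega>)"
  have h[measurable]: "?h \<in> P \<rightarrow>\<^sub>M borel"
    unfolding borel_prod[symmetric] by measurable
  have "distr P borel ?h \<in> couplings (distr P borel f) (distr P borel g)"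
    unfolding couplings_def using prob_space.prob_space_distr[OF P h]
    by (auto simp: distr_distr o_def borel_measurable_continuous_onI continuous_intros)
  moreover have "AE p in distr P borel ?h. dist (fst p) (snd p) \<le> r"
    using AE by (subst AE_distr_iff) (auto intro!: borel_closed closed_Collect_le continuous_intros)
  ultimately show ?thesis unfolding W_le_def by blast
qed

text \<open>The easy direction of Strassen's theorem: mass that starts in A ends in B. It serves to
  refute couplings of too small displacement.\<close>

lemma W_le_measure_le:
  assumes "W_le \<mu> \<nu> r" "A \<in> sets borel" "B \<in> sets borel"
    and "\<And>a b. a \<in> A \<Longrightarrow> dist a b \<le> r \<Longrightarrow> b \<in> B"
  shows "measure \<mu> A \<le> measure \<nu> B"
proof -
  obtain \<pi> where c: "\<pi> \<in> couplings \<mu> \<nu>" and ae: "AE p in \<pi>. dist (fst p) (snd p) \<le> r"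
    using assms(1) unfolding W_le_def by blast
  note C = couplingsD[OF c]
  interpret prob_space \<pi> by (rule C)
  have "measure \<mu> A = measure \<pi> (fst -` A \<inter> space \<pi>)"
    using measure_distr[OF C(6) assms(2)] C(4) by simp
  also have "\<dots> \<le> measure \<pi> (snd -` B \<inter> space \<pi>)"
  proof (rule finite_measure_mono_AE)
    show "AE x in \<pi>. x \<in> fst -` A \<inter> space \<pi> \<longrightarrow> x \<in> snd -` B \<inter> space \<pi>"
      using ae by (rule eventually_mono) (use assms(4) in auto)
  qed (use C(7) assms(3) in measurable)
  also have "\<dots> = measure \<nu> B"
    using measure_distr[OF C(7) assms(3)] C(5) by simp
  finally show ?thesis .
qed

lemma W_le_commute: "W_le \<mu> \<nu> r \<Longrightarrow> W_le \<nu> \<mu> r"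
proof -
  assume "W_le \<mu> \<nu> r"
  then obtain \<pi> where c: "\<pi> \<in> couplings \<mu> \<nu>" and ae: "AE p in \<pi>. dist (fst p) (snd p) \<le> r"
    unfolding W_le_def by blast
  note C = couplingsD[OF c]
  have "W_le (distr \<pi> borel snd) (distr \<pi> borel fst) r"
    by (rule W_leI[OF C(1) C(7) C(6)]) (use ae in \<open>simp add: dist_commute\<close>)
  then show ?thesis using C by simp
qed

section \<open>The metric on the Wasserstein space\<close>

lemma W_le_distr_pair:
  assumes P: "prob_space \<mu>" and Q: "prob_space \<nu>"
    and s: "sets \<mu> = sets (borel :: 'a::polish_space measure)" "sets \<nu> = sets (borel :: 'a measure)"
    and AE: "AE p in \<mu> \<Otimes>\<^sub>M \<nu>. dist (fst p) (snd p) \<le> r"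
  shows "W_le \<mu> \<nu> r"
proof -
  interpret m: prob_space \<mu> by fact
  interpret n: prob_space \<nu> by fact
  interpret pair_prob_space \<mu> \<nu> ..
  note [measurable_cong] = s
  have m: "fst \<in> \<mu> \<Otimes>\<^sub>M \<nu> \<rightarrow>\<^sub>M borel" "snd \<in> \<mu> \<Otimes>\<^sub>M \<nu> \<rightarrow>\<^sub>M borel" by measurable
  have 1: "distr (\<mu> \<Otimes>\<^sub>M \<nu>) borel fst = \<mu>"
    using n.distr_pair_fst[of \<mu>] by (simp add: s cong: distr_cong)
  \<comment> \<open>Swapping the factors turns the second marginal into a first one.\<close>
  have "distr (\<mu> \<Otimes>\<^sub>M \<nu>) borel snd = distr (distr (\<nu> \<Otimes>\<^sub>M \<mu>) (\<mu> \<Otimes>\<^sub>M \<nu>) (\<lambda>(x, y). (y, x))) borel snd"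
    by (subst distr_pair_swap) simp
  also have "\<dots> = distr (\<nu> \<Otimes>\<^sub>M \<mu>) borel fst"
    by (subst distr_distr) (auto simp: o_def split_beta m)
  also have "\<dots> = \<nu>" using m.distr_pair_fst[of \<nu>] by (simp add: s cong: distr_cong)
  finally show ?thesis using W_leI[OF prob_space_axioms m AE] 1 by simp
qed

text \<open>Under the product coupling both points lie almost surely in bounded sets. This is the
  finiteness of \<open>W_infinity\<close> on \<open>P_infinity\<close>.\<close>

lemma P_infinity_imp_W_le:
  assumes "\<mu> \<in> P_infinity" "\<nu> \<in> P_infinity"
  shows "\<exists>R. W_le \<mu> \<nu> R"
proof -
  interpret m: prob_space \<mu> using P_infinityD assms by blast
  interpret n: prob_space \<nu> using P_infinityD assms by blast
  interpret pair_prob_space \<mu> \<nu> ..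
  note s[measurable_cong] = P_infinityD(2)[OF assms(1)] P_infinityD(2)[OF assms(2)]
  obtain x R y S where R: "AE a in \<mu>. dist x a \<le> R" and S: "AE b in \<nu>. dist y b \<le> S"
    using assms by (auto simp: P_infinity_iff)
  have "AE p in \<mu> \<Otimes>\<^sub>M \<nu>. dist (fst p) (snd p) \<le> R + dist x y + S"
  proof (rule AE_pair_measure)
    show "AE a in \<mu>. AE b in \<nu>. dist (fst (a, b)) (snd (a, b)) \<le> R + dist x y + S"
      using R
    proof eventually_elim
      case (elim a)
      from S show ?case
      proof eventually_elim
        case (elim b)
        then show ?case using \<open>dist x a \<le> R\<close> dist_triangle[of a b x] dist_triangle[of x b y]
          by (simp add: dist_commute)
      qed
    qed
  qed measurable
  then show ?thesis
    using W_le_distr_pair[OF m.prob_space_axioms n.prob_space_axioms s] by blast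
qed

text \<open>A point is labelled by the first member of a dense sequence closer than \<epsilon>/2;
  points with equal labels share that member.\<close>

lemma fine_countable_partition:
  assumes "\<epsilon> > 0"
  shows "\<exists>c::'a::polish_space \<Rightarrow> nat. c \<in> borel \<rightarrow>\<^sub>M count_space UNIV \<and> (\<forall>x y. c x = c y \<longrightarrow> dist x y < \<epsilon>)"
proof -
  obtain D :: "'a set" where D: "countable D"
    "\<And>U. open U \<Longrightarrow> U \<noteq> {} \<Longrightarrow> \<exists>d\<in>D. d \<in> U" using countable_dense_exists by blast
  let ?d = "from_nat_into D"
  define c where "c x = (LEAST n. dist x (?d n) < \<epsilon> / 2)" for x
  have "\<exists>n. dist x (?d n) < \<epsilon> / 2" for x
  proof -
    have "open (ball x (\<epsilon>/2))" "ball x (\<epsilon>/2) \<noteq> {}" using assms by auto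
    then obtain d where "d \<in> D" "d \<in> ball x (\<epsilon>/2)" using D(2) by blast
    then show ?thesis using from_nat_into_surj[OF D(1)] by (metis mem_ball)
  qed
  then have c: "dist x (?d (c x)) < \<epsilon> / 2" for x unfolding c_def by (rule LeastI_ex)
  have "dist x y < \<epsilon>" if "c x = c y" for x y
    using c[of x] c[of y] dist_triangle2[of x y "?d (c x)"] that by simp
  moreover have "c \<in> borel \<rightarrow>\<^sub>M count_space UNIV" unfolding c_def by measurable
  ultimately show ?thesis by blast
qed

text \<open>An approximate gluing of the two couplings: the middle points are only required to lie in the
  same cell of a fine countable partition, so no disintegration is needed.\<close>
lemma W_le_trans_approx:
  fixes \<mu> \<nu> \<rho> :: "'a::polish_space measure"
  assumes 1: "W_le \<mu> \<nu> a" and 2: "W_le \<nu> \<rho> b" and \<epsilon>: "\<epsilon> > 0"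
  shows "W_le \<mu> \<rho> (a + b + \<epsilon>)"
proof -
  obtain \<pi> \<sigma> where p: "\<pi> \<in> couplings \<mu> \<nu>" "AE p in \<pi>. dist (fst p) (snd p) \<le> a"
    and s: "\<sigma> \<in> couplings \<nu> \<rho>" "AE p in \<sigma>. dist (fst p) (snd p) \<le> b"
    using 1 2 unfolding W_le_def by blast
  note P = couplingsD[OF p(1)] and S = couplingsD[OF s(1)]
  interpret p1: prob_space \<pi> by (rule P)
  interpret p2: prob_space \<sigma> by (rule S)
  interpret pair_prob_space \<pi> \<sigma> ..
  note [measurable_cong] = P(2)[folded borel_prod] S(2)[folded borel_prod]
  obtain c :: "'a \<Rightarrow> nat" where c[measurable]: "c \<in> borel \<rightarrow>\<^sub>M count_space UNIV"
    and cd: "\<And>x y. c x = c y \<Longrightarrow> dist x y < \<epsilon>"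
    using fine_countable_partition[OF \<epsilon>] by blast
  \<comment> \<open>The mass of a cell is the same for the second marginal of \<pi> and the first
    marginal of \<sigma>, both being \<nu>.\<close>
  define q where "q n = emeasure \<nu> {x. c x = n}" for n
  have cn: "{x. c x = n} \<in> sets borel" for n by measurable
  have qP: "emeasure \<pi> {p\<in>space \<pi>. c (snd p) = n} = q n" for n
    unfolding q_def using emeasure_distr[OF P(7) cn[of n]] P(3,5) by (simp add: vimage_def)
  have qS: "emeasure \<sigma> {p\<in>space \<sigma>. c (fst p) = n} = q n" for n
    unfolding q_def using emeasure_distr[OF S(6) cn[of n]] S(3,4) by (simp add: vimage_def)
  have qfin: "q n \<noteq> \<top>" for n using qP[of n] p1.emeasure_finite by metis
  \<comment> \<open>Relative to the product, this density makes the couplings conditionally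
    independent given a common label of the two middle points. On cells of mass zero the inverse is
    infinite, but almost no point lies in such a cell.\<close>
  define f where "f \<omega> = (if c (snd (fst \<omega>)) = c (fst (snd \<omega>)) then inverse (q (c (snd (fst \<omega>)))) else 0)"
    for \<omega> :: "('a \<times> 'a) \<times> 'a \<times> 'a"
  have c1: "(\<lambda>\<omega>. c (snd (fst \<omega>))) \<in> \<pi> \<Otimes>\<^sub>M \<sigma> \<rightarrow>\<^sub>M count_space UNIV"
    and c2: "(\<lambda>\<omega>. c (fst (snd \<omega>))) \<in> \<pi> \<Otimes>\<^sub>M \<sigma> \<rightarrow>\<^sub>M count_space UNIV" by measurable
  have "{\<omega> \<in> space (\<pi> \<Otimes>\<^sub>M \<sigma>). c (snd (fst \<omega>)) = c (fst (snd \<omega>))} \<in> sets (\<pi> \<Otimes>\<^sub>M \<sigma>)"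
    (is "?E \<in> _")
  proof -
    have "?E = (\<Union>n. ((\<lambda>\<omega>. c (snd (fst \<omega>))) -` {n} \<inter> space (\<pi> \<Otimes>\<^sub>M \<sigma>)) \<inter>
        ((\<lambda>\<omega>. c (fst (snd \<omega>))) -` {n} \<inter> space (\<pi> \<Otimes>\<^sub>M \<sigma>)))" by auto
    also have "\<dots> \<in> sets (\<pi> \<Otimes>\<^sub>M \<sigma>)"
      by (intro sets.countable_UN image_subsetI sets.Int measurable_sets[OF c1] measurable_sets[OF c2]) auto
    finally show ?thesis .
  qed
  moreover have "(\<lambda>\<omega>. inverse (q (c (snd (fst \<omega>))))) \<in> borel_measurable (\<pi> \<Otimes>\<^sub>M \<sigma>)"
    by (rule measurable_compose[OF c1]) simp
  ultimately have [measurable]: "f \<in> borel_measurable (\<pi> \<Otimes>\<^sub>M \<sigma>)"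
    unfolding f_def by (intro measurable_If) auto
  have pos: "AE x in \<nu>. q (c x) \<noteq> 0"
  proof -
    have "AE x in \<nu>. q n = 0 \<longrightarrow> c x \<noteq> n" for n
    proof (cases "q n = 0")
      case True
      then have "{x. c x = n} \<in> null_sets \<nu>" using cn unfolding q_def P(5)[symmetric] by auto
      from AE_not_in[OF this] show ?thesis by simp
    qed simp
    then have "AE x in \<nu>. \<forall>n. q n = 0 \<longrightarrow> c x \<noteq> n" by (simp add: AE_all_countable)
    then show ?thesis by (rule eventually_mono) auto
  qed
  have posP: "AE p in \<pi>. q (c (snd p)) \<noteq> 0"
    using AE_distrD[OF P(7)] pos unfolding P(5) by blast
  have posS: "AE t in \<sigma>. q (c (fst t)) \<noteq> 0"
    using AE_distrD[OF S(6)] pos unfolding S(4) by blast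
  have inv: "inverse (q n) * q n = 1" if "q n \<noteq> 0" for n
    using that qfin by (metis ennreal_divide_self divide_ennreal_def mult.commute top.not_eq_extremum)
  have intS: "(\<integral>\<^sup>+ t. f (p, t) \<partial>\<sigma>) = 1" if "q (c (snd p)) \<noteq> 0" for p
  proof -
    have "(\<integral>\<^sup>+ t. f (p, t) \<partial>\<sigma>) = (\<integral>\<^sup>+ t. inverse (q (c (snd p))) * indicator {t\<in>space \<sigma>. c (fst t) = c (snd p)} t \<partial>\<sigma>)"
      by (intro nn_integral_cong) (auto simp: f_def)
    also have "\<dots> = 1"
      by (subst nn_integral_cmult_indicator) (auto simp: qS inv[OF that])
    finally show ?thesis .
  qed
  have intP: "(\<integral>\<^sup>+ p. f (p, t) \<partial>\<pi>) = 1" if "q (c (fst t)) \<noteq> 0" for t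
  proof -
    have "(\<integral>\<^sup>+ p. f (p, t) \<partial>\<pi>) = (\<integral>\<^sup>+ p. inverse (q (c (fst t))) * indicator {p\<in>space \<pi>. c (snd p) = c (fst t)} p \<partial>\<pi>)"
      by (intro nn_integral_cong) (auto simp: f_def)
    also have "\<dots> = 1"
      by (subst nn_integral_cmult_indicator) (auto simp: qP inv[OF that])
    finally show ?thesis .
  qed
  define Q where "Q = density (\<pi> \<Otimes>\<^sub>M \<sigma>) f"
  have d1: "distr Q borel (\<lambda>\<omega>. fst (fst \<omega>)) = \<mu>"
  proof (rule measure_eqI)
    show "sets (distr Q borel (\<lambda>\<omega>. fst (fst \<omega>))) = sets \<mu>" using P(4) by auto
    fix A assume "A \<in> sets (distr Q borel (\<lambda>\<omega>. fst (fst \<omega>)))"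
    then have A[measurable]: "A \<in> sets borel" by simp
    have "emeasure (distr Q borel (\<lambda>\<omega>. fst (fst \<omega>))) A =
        (\<integral>\<^sup>+ \<omega>. f \<omega> * indicator A (fst (fst \<omega>)) \<partial>(\<pi> \<Otimes>\<^sub>M \<sigma>))"
      unfolding Q_def
      by (subst emeasure_distr) (auto simp: emeasure_density intro!: nn_integral_cong split: split_indicator)
    also have "\<dots> = (\<integral>\<^sup>+ p. \<integral>\<^sup>+ t. f (p, t) * indicator A (fst p) \<partial>\<sigma> \<partial>\<pi>)"
      by (subst p2.nn_integral_fst[symmetric]) auto
    also have "\<dots> = (\<integral>\<^sup>+ p. indicator A (fst p) \<partial>\<pi>)"
    proof (rule nn_integral_cong_AE)
      show "AE p in \<pi>. (\<integral>\<^sup>+ t. f (p, t) * indicator A (fst p) \<partial>\<sigma>) = indicator A (fst p)"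
        using posP by (rule eventually_mono) (simp add: intS split: split_indicator)
    qed
    also have "\<dots> = emeasure \<mu> A"
      unfolding P(4)[symmetric] by (subst nn_integral_distr[symmetric, of fst \<pi> borel]) auto
    finally show "emeasure (distr Q borel (\<lambda>\<omega>. fst (fst \<omega>))) A = emeasure \<mu> A" .
  qed
  have d2: "distr Q borel (\<lambda>\<omega>. snd (snd \<omega>)) = \<rho>"
  proof (rule measure_eqI)
    show "sets (distr Q borel (\<lambda>\<omega>. snd (snd \<omega>))) = sets \<rho>" using S(5) by auto
    fix A assume "A \<in> sets (distr Q borel (\<lambda>\<omega>. snd (snd \<omega>)))"
    then have A[measurable]: "A \<in> sets borel" by simp
    have "emeasure (distr Q borel (\<lambda>\<omega>. snd (snd \<omega>))) A =
        (\<integral>\<^sup>+ \<omega>. f \<omega> * indicator A (snd (snd \<omega>)) \<partial>(\<pi> \<Otimes>\<^sub>M \<sigma>))"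
      unfolding Q_def
      by (subst emeasure_distr) (auto simp: emeasure_density intro!: nn_integral_cong split: split_indicator)
    also have "\<dots> = (\<integral>\<^sup>+ t. \<integral>\<^sup>+ p. f (p, t) * indicator A (snd t) \<partial>\<pi> \<partial>\<sigma>)"
      by (subst nn_integral_snd[symmetric]) auto
    also have "\<dots> = (\<integral>\<^sup>+ t. indicator A (snd t) \<partial>\<sigma>)"
    proof (rule nn_integral_cong_AE)
      show "AE t in \<sigma>. (\<integral>\<^sup>+ p. f (p, t) * indicator A (snd t) \<partial>\<pi>) = indicator A (snd t)"
        using posS by (rule eventually_mono) (simp add: intP split: split_indicator)
    qed
    also have "\<dots> = emeasure \<rho> A"
      unfolding S(5)[symmetric] by (subst nn_integral_distr[symmetric, of snd \<sigma> borel]) auto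
    finally show "emeasure (distr Q borel (\<lambda>\<omega>. snd (snd \<omega>))) A = emeasure \<rho> A" .
  qed
  \<comment> \<open>The total mass of Q is read off from its first marginal.\<close>
  have "prob_space \<mu>" unfolding P(4)[symmetric] by (rule p1.prob_space_distr) measurable
  then have Q: "prob_space Q"
    unfolding d1[symmetric] by (rule prob_space_distrD[rotated]) (simp add: Q_def)
  have aP: "AE \<omega> in \<pi> \<Otimes>\<^sub>M \<sigma>. dist (fst (fst \<omega>)) (snd (fst \<omega>)) \<le> a"
    by (rule AE_pair_measure) (use p(2) in auto)
  have "AE t in \<sigma>. dist (fst t) (snd t) \<le> b" by (rule s(2))
  then have aS: "AE \<omega> in \<pi> \<Otimes>\<^sub>M \<sigma>. dist (fst (snd \<omega>)) (snd (snd \<omega>)) \<le> b"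
    by (intro AE_pair_measure) auto
  \<comment> \<open>Where the density is positive the labels agree, so jumping between the middle
    points costs less than \<epsilon>.\<close>
  have "AE \<omega> in \<pi> \<Otimes>\<^sub>M \<sigma>. 0 < f \<omega> \<longrightarrow> dist (fst (fst \<omega>)) (snd (snd \<omega>)) \<le> a + b + \<epsilon>"
    using aP aS
  proof eventually_elim
    case (elim \<omega>)
    show ?case
    proof
      assume "0 < f \<omega>"
      then have "c (snd (fst \<omega>)) = c (fst (snd \<omega>))" by (auto simp: f_def split: if_splits)
      then have "dist (snd (fst \<omega>)) (fst (snd \<omega>)) < \<epsilon>" by (rule cd)
      then show "dist (fst (fst \<omega>)) (snd (snd \<omega>)) \<le> a + b + \<epsilon>"
        using elim dist_triangle[of "fst (fst \<omega>)" "snd (snd \<omega>)" "snd (fst \<omega>)"]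
          dist_triangle[of "snd (fst \<omega>)" "snd (snd \<omega>)" "fst (snd \<omega>)"] by simp
    qed
  qed
  then have "AE \<omega> in Q. dist (fst (fst \<omega>)) (snd (snd \<omega>)) \<le> a + b + \<epsilon>"
    unfolding Q_def by (subst AE_density) auto
  from W_leI[OF Q _ _ this] show ?thesis unfolding d1 d2 by (simp add: Q_def)
qed

section \<open>Metric axioms for the Wasserstein distance\<close>

lemma W_infinity_less_W_le:
  assumes "\<mu> \<in> P_infinity" "\<nu> \<in> P_infinity" "W_infinity \<mu> \<nu> < r"
  shows "W_le \<mu> \<nu> r"
  using P_infinity_imp_W_le[OF assms(1,2)] W_infinity_less_imp_W_le assms(3) by blast

text \<open>\<open>Metric_space\<close> demands symmetry for arbitrary arguments, also outside
  \<open>P_infinity\<close>. There the infimum may be infinite, so the comparison is made before the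
  conversion to reals.\<close>

lemma INF_coupling_norm_commute_le:
  "(INF \<pi>\<in>couplings \<mu> \<nu>. coupling_norm \<pi>) \<le> (INF \<pi>\<in>couplings \<nu> \<mu>. coupling_norm \<pi>)"
proof (rule INF_greatest, rule ereal_le_real)
  fix \<pi> r assume \<pi>: "\<pi> \<in> couplings \<nu> \<mu>" and r: "coupling_norm \<pi> \<le> ereal r"
  then have "W_le \<mu> \<nu> r"
    using coupling_norm_le_iff[OF \<pi>] W_le_commute unfolding W_le_def by blast
  then obtain \<sigma> where "\<sigma> \<in> couplings \<mu> \<nu>" "coupling_norm \<sigma> \<le> ereal r"
    using coupling_norm_le_iff unfolding W_le_def by blast
  then show "(INF \<pi>\<in>couplings \<mu> \<nu>. coupling_norm \<pi>) \<le> ereal r" by (meson INF_lower2)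
qed

lemma W_infinity_commute: "W_infinity \<mu> \<nu> = W_infinity \<nu> \<mu>"
  unfolding W_infinity_def by (metis INF_coupling_norm_commute_le antisym)

lemma W_infinity_nonneg: "0 \<le> W_infinity \<mu> \<nu>"
  unfolding W_infinity_def
  by (intro real_of_ereal_pos INF_greatest coupling_norm_nonneg)

text \<open>The \<mu>-mass of A is at most the \<nu>-mass of each closed 1/(n+1)-neighbourhood, and
  these decrease to A because A is closed.\<close>

lemma measure_closed_le_of_W_infinity_0:
  assumes m: "\<mu> \<in> P_infinity" "\<nu> \<in> P_infinity" and 0: "W_infinity \<mu> \<nu> = 0" and A: "closed A"
  shows "measure \<mu> A \<le> measure \<nu> A"
\<comment> \<open>By convention \<open>infdist\<close> to the empty set is 0, which would make every
  neighbourhood the whole space.\<close>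
proof (cases "A = {}")
  case False
  interpret n: prob_space \<nu> using P_infinityD m by blast
  define B where "B n = {x. infdist x A \<le> 1 / Suc n}" for n
  have B: "B n \<in> sets borel" for n
    unfolding B_def by (intro borel_closed closed_Collect_le continuous_intros)
  have le: "measure \<mu> A \<le> measure \<nu> (B n)" for n
  proof (rule W_le_measure_le[of _ _ "1 / Suc n"])
    show "W_le \<mu> \<nu> (1 / Suc n)" by (rule W_infinity_less_W_le) (use m 0 in auto)
    show "\<And>a b. a \<in> A \<Longrightarrow> dist a b \<le> 1 / real (Suc n) \<Longrightarrow> b \<in> B n"
      unfolding B_def using infdist_le by (metis dist_commute mem_Collect_eq order_trans)
  qed (use A B in auto)
  have "decseq B"
    unfolding decseq_def B_def by (auto elim!: order_trans simp: frac_le)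
  then have "(\<lambda>n. measure \<nu> (B n)) \<longlonglongrightarrow> measure \<nu> (\<Inter>n. B n)"
    using B P_infinityD(2)[OF m(2)] by (intro n.finite_Lim_measure_decseq) auto
  moreover have "(\<Inter>n. B n) = A"
  proof
    show "(\<Inter>n. B n) \<subseteq> A"
    proof
      fix x assume x: "x \<in> (\<Inter>n. B n)"
      have "infdist x A \<le> 0"
      proof (rule ccontr)
        assume "\<not> infdist x A \<le> 0"
        then obtain n where "1 / Suc n < infdist x A"
          using nat_approx_posE[of "infdist x A"] by (metis not_le of_nat_Suc)
        moreover have "infdist x A \<le> 1 / Suc n" using x unfolding B_def by blast
        ultimately show False by simp
      qed
      then show "x \<in> A"
        using in_closed_iff_infdist_zero[OF A False] infdist_nonneg[of x A] by auto
    qed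
  qed (auto simp: B_def)
  ultimately have "(\<lambda>n. measure \<nu> (B n)) \<longlonglongrightarrow> measure \<nu> A" by simp
  then show ?thesis by (rule LIMSEQ_le_const) (use le in blast)
qed simp

text \<open>By symmetry the measures agree on closed sets, an intersection-stable generator of the
  Borel sets.\<close>

lemma W_infinity_0_imp_eq:
  assumes m: "\<mu> \<in> P_infinity" "\<nu> \<in> P_infinity" and 0: "W_infinity \<mu> \<nu> = 0"
  shows "\<mu> = \<nu>"
proof (rule measure_eqI_generator_eq[where E="Collect closed" and \<Omega>=UNIV and A="\<lambda>_. UNIV"])
  interpret m: prob_space \<mu> using P_infinityD m by blast
  interpret n: prob_space \<nu> using P_infinityD m by blast
  have sym0: "W_infinity \<nu> \<mu> = 0"
    using 0 W_infinity_commute by metis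
  show "emeasure \<mu> X = emeasure \<nu> X" if "X \<in> Collect closed" for X
    using measure_closed_le_of_W_infinity_0[OF m 0] measure_closed_le_of_W_infinity_0[OF m(2,1) sym0] that
    by (simp add: m.emeasure_eq_measure n.emeasure_eq_measure antisym)
  show "Int_stable (Collect closed :: 'a set set)" by (auto simp: Int_stable_def)
  show "emeasure \<mu> UNIV \<noteq> \<infinity>" by simp
  show "sets \<mu> = sigma_sets UNIV (Collect closed)" "sets \<nu> = sigma_sets UNIV (Collect closed)"
    using P_infinityD(2)[OF m(1)] P_infinityD(2)[OF m(2)] by (simp_all add: borel_eq_closed)
qed auto

lemma W_le_refl:
  assumes m: "\<mu> \<in> P_infinity"
  shows "W_le \<mu> \<mu> 0"
proof -
  have i: "id \<in> \<mu> \<rightarrow>\<^sub>M borel" using P_infinityD(2)[OF m] by (simp add: measurable_cong_sets[of \<mu> borel borel borel])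
  have "distr \<mu> borel id = \<mu>"
    using distr_id[of \<mu>] P_infinityD(2)[OF m] by (simp add: id_def cong: distr_cong)
  then show ?thesis using W_leI[OF P_infinityD(1)[OF m] i i, of 0] by simp
qed

lemma Metric_space_P_infinity: "Metric_space P_infinity W_infinity"
proof (unfold_locales)
  show "0 \<le> W_infinity \<mu> \<nu>" "W_infinity \<mu> \<nu> = W_infinity \<nu> \<mu>" for \<mu> \<nu> :: "'a measure"
    by (rule W_infinity_nonneg W_infinity_commute)+
next
  fix \<mu> \<nu> :: "'a measure" assume m: "\<mu> \<in> P_infinity" "\<nu> \<in> P_infinity"
  show "W_infinity \<mu> \<nu> = 0 \<longleftrightarrow> \<mu> = \<nu>"
    using W_infinity_0_imp_eq[OF m] W_le_imp_W_infinity_le[OF W_le_refl[OF m(1)]] by auto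
next
  fix \<mu> \<nu> \<rho> :: "'a measure" assume m: "\<mu> \<in> P_infinity" "\<nu> \<in> P_infinity" and r: "\<rho> \<in> P_infinity"
  show "W_infinity \<mu> \<rho> \<le> W_infinity \<mu> \<nu> + W_infinity \<nu> \<rho>"
  proof (rule field_le_epsilon)
    fix e :: real assume "e > 0"
    \<comment> \<open>Two thirds of e make the bounds on the two distances strict, the last third
      pays for the approximate gluing.\<close>
    then have "W_le \<mu> \<rho> ((W_infinity \<mu> \<nu> + e/3) + (W_infinity \<nu> \<rho> + e/3) + e/3)"
      using m r by (intro W_le_trans_approx[where \<nu>=\<nu>] W_infinity_less_W_le) auto
    then show "W_infinity \<mu> \<rho> \<le> W_infinity \<mu> \<nu> + W_infinity \<nu> \<rho> + e"
      using W_le_imp_W_infinity_le(1) by fastforce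
  qed
qed

section \<open>Dirac measures\<close>

lemma measure_ball_support_pos:
  assumes m: "\<mu> \<in> P_infinity" and y: "y \<in> measure_support \<mu>" and r: "r > 0"
  shows "0 < measure \<mu> (ball y r)"
proof -
  interpret prob_space \<mu> using P_infinityD m by blast
  have "0 < emeasure \<mu> (ball y r)" using y r unfolding measure_support_def by simp
  then show ?thesis by (simp add: emeasure_eq_measure)
qed

lemma return_in_P_infinity: "return borel x \<in> P_infinity"
  unfolding P_infinity_iff
proof (intro conjI exI)
  show "AE y in return borel x. dist x y \<le> 0"
    by (subst AE_return) (auto intro!: borel_closed closed_Collect_le continuous_intros)
qed (auto intro: prob_space_return)

lemma W_le_return:
  assumes m: "\<mu> \<in> P_infinity" and AE: "AE a in \<mu>. dist a z \<le> r"
  shows "W_le \<mu> (return borel z) r"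
proof -
  interpret prob_space \<mu> using P_infinityD m by blast
  have i: "(\<lambda>x. x) \<in> \<mu> \<rightarrow>\<^sub>M borel" using P_infinityD(2)[OF m] by (simp add: measurable_cong_sets[of \<mu> borel borel borel])
  have 1: "distr \<mu> borel (\<lambda>x. x) = \<mu>"
    using distr_id[of \<mu>] P_infinityD(2)[OF m] by (simp add: id_def cong: distr_cong)
  have 2: "distr \<mu> borel (\<lambda>_. z) = return borel z" by (rule distr_const) simp
  show ?thesis using W_leI[OF prob_space_axioms i _ AE] unfolding 1 2 by simp
qed

text \<open>If W were smaller, a small ball around y, of positive mass, would be moved too little to
  reach z, where the whole Dirac mass sits. With the next lemma, W to a Dirac measure is the
  supremum of the distances from the support.\<close>

lemma support_dist_le_W_infinity_return:
  assumes m: "\<mu> \<in> P_infinity" and y: "y \<in> measure_support \<mu>"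
  shows "dist y z \<le> W_infinity \<mu> (return borel z)"
proof (rule ccontr)
  assume n: "\<not> ?thesis"
  obtain r where r: "W_infinity \<mu> (return borel z) < r" "r < dist y z"
    using n dense[of "W_infinity \<mu> (return borel z)" "dist y z"] by auto
  have "measure \<mu> (ball y (dist y z - r)) \<le> measure (return borel z) (- {z})"
  proof (rule W_le_measure_le)
    show "W_le \<mu> (return borel z) r" by (rule W_infinity_less_W_le[OF m return_in_P_infinity r(1)])
    show "b \<in> - {z}" if "a \<in> ball y (dist y z - r)" "dist a b \<le> r" for a b
      using that dist_triangle[of y z a] by auto
  qed auto
  also have "\<dots> = 0" by (simp add: measure_return)
  finally show False using measure_ball_support_pos[OF m y, of "dist y z - r"] r(2) by simp
qed

text \<open>Otherwise moving everything to z would cost at most W - e.\<close>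

lemma ex_support_dist_W_infinity_return:
  assumes m: "\<mu> \<in> P_infinity" and e: "e > 0"
  shows "\<exists>y\<in>measure_support \<mu>. W_infinity \<mu> (return borel z) - e \<le> dist y z"
proof (rule ccontr)
  assume n: "\<not> ?thesis"
  have "AE a in \<mu>. dist a z \<le> W_infinity \<mu> (return borel z) - e"
    using AE_measure_support[OF P_infinityD(2)[OF m]] by (rule eventually_mono) (use n in force)
  from W_le_imp_W_infinity_le(1)[OF W_le_return[OF m this]] show False using e by simp
qed

lemma measure_support_nonempty:
  assumes m: "\<mu> \<in> P_infinity"
  shows "measure_support \<mu> \<noteq> {}"
  using ex_support_dist_W_infinity_return[OF m, of 1] by fastforce

lemma W_infinity_return_return: "W_infinity (return borel x) (return borel z) = dist x z"
proof (rule antisym)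
  have "AE a in return borel x. dist a z \<le> dist x z"
    by (subst AE_return) (auto intro!: borel_closed closed_Collect_le continuous_intros)
  then show "W_infinity (return borel x) (return borel z) \<le> dist x z"
    using W_le_imp_W_infinity_le(1)[OF W_le_return[OF return_in_P_infinity]] by blast
  have "x \<in> measure_support (return borel x)"
    by (auto simp: measure_support_def)
  then show "dist x z \<le> W_infinity (return borel x) (return borel z)"
    by (rule support_dist_le_W_infinity_return[OF return_in_P_infinity])
qed

section \<open>From the Wasserstein space to the base space\<close>

lemma gromov_compactifiable_of_P_infinity:
  assumes gc: "Metric_space.gromov_compactifiable (P_infinity :: 'a::polish_space measure set) W_infinity"
  shows "Metric_space.gromov_compactifiable (UNIV :: 'a set) dist"
proof (rule Metric_space.gap_imp_gromov_compactifiable[OF Met_TC.Metric_space_axioms])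
  fix z0 :: 'a and \<epsilon> :: real assume \<epsilon>: "\<epsilon> > 0"
  obtain F \<delta> where "finite F \<and> F \<subseteq> P_infinity \<and> \<delta> > 0 \<and>
    (\<forall>\<nu>\<in>P_infinity. \<epsilon> \<le> W_infinity (return borel z0) \<nu> \<longrightarrow>
      (\<exists>\<mu>\<in>F. W_infinity \<mu> \<nu> + \<delta> \<le> W_infinity \<mu> (return borel z0) + W_infinity (return borel z0) \<nu>))"
    using Metric_space.gromov_compactifiable_imp_gap[OF Metric_space_P_infinity gc return_in_P_infinity[of z0] \<epsilon>]
    by (elim exE) (rule that)
  then have F: "finite F" "F \<subseteq> P_infinity" "\<delta> > 0"
    and gap: "\<And>\<nu>. \<nu> \<in> P_infinity \<Longrightarrow> \<epsilon> \<le> W_infinity (return borel z0) \<nu> \<Longrightarrow>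
      \<exists>\<mu>\<in>F. W_infinity \<mu> \<nu> + \<delta> \<le> W_infinity \<mu> (return borel z0) + W_infinity (return borel z0) \<nu>"
    by simp_all
  \<comment> \<open>Almost maximal distance from z0 costs half of \<delta>; towards every other z,
    mere membership in the support gives the right inequality.\<close>
  have "\<exists>y\<in>measure_support \<mu>. W_infinity \<mu> (return borel z0) - \<delta>/2 \<le> dist y z0" if "\<mu> \<in> F" for \<mu>
    by (rule ex_support_dist_W_infinity_return) (use that F(2,3) in auto)
  then obtain Y where Y: "\<And>\<mu>. \<mu> \<in> F \<Longrightarrow> Y \<mu> \<in> measure_support \<mu>"
    "\<And>\<mu>. \<mu> \<in> F \<Longrightarrow> W_infinity \<mu> (return borel z0) - \<delta>/2 \<le> dist (Y \<mu>) z0"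
    by metis
  have "\<exists>y\<in>Y ` F. dist y z + \<delta>/2 \<le> dist y z0 + dist z0 z" if z: "\<epsilon> \<le> dist z0 z" for z
  proof -
    obtain \<mu> where \<mu>: "\<mu> \<in> F"
      "W_infinity \<mu> (return borel z) + \<delta> \<le> W_infinity \<mu> (return borel z0) + dist z0 z"
      using gap[OF return_in_P_infinity, of z] z unfolding W_infinity_return_return by blast
    have "dist (Y \<mu>) z \<le> W_infinity \<mu> (return borel z)"
      using support_dist_le_W_infinity_return Y(1) \<mu>(1) F(2) by blast
    then show ?thesis using \<mu> Y(2)[OF \<mu>(1)] by (intro bexI[of _ "Y \<mu>"]) auto
  qed
  then show "\<exists>F \<delta>. finite F \<and> F \<subseteq> UNIV \<and> \<delta> > 0 \<and>
      (\<forall>z\<in>UNIV. \<epsilon> \<le> dist z0 z \<longrightarrow> (\<exists>y\<in>F. dist y z + \<delta> \<le> dist y z0 + dist z0 z))"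
    using F(1,3) by (intro exI[of _ "Y ` F"] exI[of _ "\<delta>/2"]) auto
qed simp

section \<open>Relocating mass\<close>

text \<open>Along radii increasing to b the mass of the balls is monotone and bounded, hence Cauchy,
  so some step gains less than w.\<close>

lemma ex_light_annulus:
  fixes \<mu> :: "'a::polish_space measure"
  assumes m: "\<mu> \<in> P_infinity" and ab: "a < b" and w: "w > 0"
  shows "\<exists>s t. a < s \<and> s < t \<and> t < b \<and> measure \<mu> (cball y t) < measure \<mu> (cball y s) + w"
proof -
  interpret prob_space \<mu> using P_infinityD m by blast
  define u where "u n = b - (b - a) / (real n + 2)" for n
  define G where "G n = measure \<mu> (cball y (u n))" for n
  have u: "a < u n" "u n < u (Suc n)" "u n < b" for n
  proof -
    have "(b - a) / (real n + 2) < (b - a) / 1"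
      using ab by (intro divide_strict_left_mono) auto
    moreover have "(b - a) / (real (Suc n) + 2) < (b - a) / (real n + 2)"
      using ab by (intro divide_strict_left_mono) auto
    moreover have "0 < (b - a) / (real n + 2)" using ab by simp
    ultimately show "a < u n" "u n < u (Suc n)" "u n < b" unfolding u_def by simp_all
  qed
  have "G n \<le> G (Suc n)" for n
    unfolding G_def using u(2)[of n] P_infinityD(2)[OF m]
    by (intro finite_measure_mono) (auto simp: subset_cball)
  then have "incseq G" by (rule incseq_SucI)
  moreover have "Bseq G" unfolding G_def by (rule BseqI'[of _ 1]) (simp)
  ultimately have "Cauchy G"
    by (intro convergent_Cauchy Bseq_mono_convergent) (auto dest: incseqD)
  then obtain M where "norm (G (Suc M) - G M) < w" using CauchyD[OF _ w] by (metis le_refl le_SucI)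
  then have "G (Suc M) < G M + w" by simp
  then show ?thesis using u[of M] u[of "Suc M"] unfolding G_def by blast
qed

text \<open>All of \<open>Q\<close> and a mass \<open>w\<close> taken uniformly from \<open>C\<close> go to \<open>y\<close>. Collapsing the rest of \<open>B\<close> to
  \<open>x\<close> makes the resulting law independent of the choice of \<open>C\<close> inside \<open>B\<close>.\<close>
lemma mass_relocation:
  fixes f :: "'b \<Rightarrow> 'a::polish_space"
  assumes P: "prob_space P" and f: "f \<in> P \<rightarrow>\<^sub>M borel"
    and sets: "Q \<in> sets P" "B \<in> sets P" "C \<in> sets P"
    and QB: "Q \<inter> B = {}" and CB: "C \<subseteq> B" and w: "0 < w" "w \<le> measure P C"
  obtains \<rho> where "prob_space \<rho>" "sets \<rho> = sets borel"
    "\<And>A. A \<in> sets borel \<Longrightarrow> measure \<rho> A = measure P (f -` A \<inter> (space P - (Q \<union> B)))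
      + (measure P Q + w) * indicator A y + (measure P B - w) * indicator A x"
    "\<And>g r. g \<in> P \<rightarrow>\<^sub>M borel \<Longrightarrow> (AE \<omega> in P. (\<omega> \<in> Q \<union> C \<longrightarrow> dist y (g \<omega>) \<le> r) \<and>
        (\<omega> \<in> B \<longrightarrow> dist x (g \<omega>) \<le> r) \<and> (\<omega> \<notin> Q \<union> B \<longrightarrow> dist (f \<omega>) (g \<omega>) \<le> r)) \<Longrightarrow>
      W_le \<rho> (distr P borel g) r"
proof -
  \<comment> \<open>An independent coin removes exactly the mass w from C, even if C has atoms and
    no subset of that mass.\<close>
  define U where "U = measure_pmf (bernoulli_pmf (w / measure P C))"
  interpret P: prob_space P by fact
  interpret U: prob_space U unfolding U_def by (rule prob_space_measure_pmf)
  interpret N: pair_prob_space P U ..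
  have [measurable_cong]: "sets U = sets (count_space UNIV)" by (simp add: U_def)
  have spU: "space U = UNIV" by (simp add: U_def)
  have setsU: "Y \<in> sets U" for Y by (simp add: U_def)
  have U: "measure U {True} = w / measure P C" "measure U {False} = 1 - w / measure P C"
    using w by (simp_all add: U_def measure_pmf_single)
  note [measurable] = f sets
  define T where "T p = (if fst p \<in> Q \<or> fst p \<in> C \<and> snd p then y else if fst p \<in> B then x else f (fst p))" for p
  have T[measurable]: "T \<in> P \<Otimes>\<^sub>M U \<rightarrow>\<^sub>M borel" unfolding T_def by measurable
  have Nt: "measure (P \<Otimes>\<^sub>M U) (X \<times> Y) = measure P X * measure U Y" if "X \<in> sets P" for X Y
    using that setsU by (simp add: measure_def U.emeasure_pair_measure_Times enn2real_mult)
  define E where "E = space P - (Q \<union> B)"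
  have E[measurable]: "E \<in> sets P" by (auto simp: E_def)
  have meas: "measure (distr (P \<Otimes>\<^sub>M U) borel T) A = measure P (f -` A \<inter> E)
      + (measure P Q + w) * indicator A y + (measure P B - w) * indicator A x" if A: "A \<in> sets borel" for A
  proof -
    \<comment> \<open>The map T is constant on each of the pieces Q, C with either outcome of the
      coin, and B - C, so each contributes to the preimage of A either entirely or not at all.
      Together with the part outside Q and B this cuts the preimage into five rectangles.\<close>
    define R where "R S z = (if z \<in> A then S else {})" for S :: "'b set" and z
    have R: "R S z \<in> sets P" if "S \<in> sets P" for S z using that by (simp add: R_def)
    have fA: "f -` A \<inter> E \<in> sets P"
      using measurable_sets[OF f A] E sets.sets_into_space[OF E]
      by (metis Int_assoc inf.absorb_iff2 sets.Int)
    let ?S1 = "(f -` A \<inter> E) \<times> UNIV" and ?S2 = "R Q y \<times> UNIV" and ?S3 = "R C y \<times> {True}"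
    let ?S4 = "R C x \<times> {False}" and ?S5 = "R (B - C) x \<times> UNIV"
    have s: "?S1 \<in> sets (P \<Otimes>\<^sub>M U)" "?S2 \<in> sets (P \<Otimes>\<^sub>M U)" "?S3 \<in> sets (P \<Otimes>\<^sub>M U)"
      "?S4 \<in> sets (P \<Otimes>\<^sub>M U)" "?S5 \<in> sets (P \<Otimes>\<^sub>M U)"
      by (intro pair_measureI fA R setsU sets sets.Diff)+
    have "measure (distr (P \<Otimes>\<^sub>M U) borel T) A = measure (P \<Otimes>\<^sub>M U) (T -` A \<inter> space (P \<Otimes>\<^sub>M U))"
      by (rule measure_distr[OF T A])
    also have "T -` A \<inter> space (P \<Otimes>\<^sub>M U) = ?S1 \<union> (?S2 \<union> (?S3 \<union> (?S4 \<union> ?S5)))"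
      using sets[THEN sets.sets_into_space] QB CB
      by (auto simp: T_def R_def E_def space_pair_measure spU split: if_splits)
    also have "measure (P \<Otimes>\<^sub>M U) \<dots> = measure (P \<Otimes>\<^sub>M U) ?S1 + (measure (P \<Otimes>\<^sub>M U) ?S2 +
        (measure (P \<Otimes>\<^sub>M U) ?S3 + (measure (P \<Otimes>\<^sub>M U) ?S4 + measure (P \<Otimes>\<^sub>M U) ?S5)))"
    proof -
      have d: "?S4 \<inter> ?S5 = {}" "?S3 \<inter> (?S4 \<union> ?S5) = {}" "?S2 \<inter> (?S3 \<union> (?S4 \<union> ?S5)) = {}"
        "?S1 \<inter> (?S2 \<union> (?S3 \<union> (?S4 \<union> ?S5))) = {}"
        using QB CB by (auto simp: R_def E_def split: if_splits)
      show ?thesis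
        using s by (simp add: N.finite_measure_Union d del: Un_iff)
    qed
    also have "\<dots> = measure P (f -` A \<inter> E) + (measure P Q + w) * indicator A y + (measure P B - w) * indicator A x"
    proof -
      have B: "measure P B = measure P C + measure P (B - C)"
        using P.finite_measure_Diff[OF sets(2,3) CB] by simp
      show ?thesis
        using w U.prob_space spU by (simp add: Nt fA R sets U R_def indicator_def B field_simps)
    qed
    finally show ?thesis .
  qed
  have W: "W_le (distr (P \<Otimes>\<^sub>M U) borel T) (distr P borel g) r"
    if g: "g \<in> P \<rightarrow>\<^sub>M borel" and ae: "AE \<omega> in P. (\<omega> \<in> Q \<union> C \<longrightarrow> dist y (g \<omega>) \<le> r) \<and>
        (\<omega> \<in> B \<longrightarrow> dist x (g \<omega>) \<le> r) \<and> (\<omega> \<notin> Q \<union> B \<longrightarrow> dist (f \<omega>) (g \<omega>) \<le> r)" for g r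
  proof -
    have fst: "fst \<in> P \<Otimes>\<^sub>M U \<rightarrow>\<^sub>M P" by measurable
    \<comment> \<open>A map that ignores the coin keeps its law.\<close>
    have "distr P borel g = distr (P \<Otimes>\<^sub>M U) borel (\<lambda>p. g (fst p))"
      using distr_distr[OF g fst] U.distr_pair_fst[of P] by (simp add: o_def)
    moreover have "AE p in P \<Otimes>\<^sub>M U. dist (T p) (g (fst p)) \<le> r"
    proof -
      have "AE p in P \<Otimes>\<^sub>M U. (fst p \<in> Q \<union> C \<longrightarrow> dist y (g (fst p)) \<le> r) \<and>
          (fst p \<in> B \<longrightarrow> dist x (g (fst p)) \<le> r) \<and>
          (fst p \<notin> Q \<union> B \<longrightarrow> dist (f (fst p)) (g (fst p)) \<le> r)"
        by (rule AE_distrD[OF fst]) (simp only: U.distr_pair_fst ae)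
      then show ?thesis by (rule eventually_mono) (auto simp: T_def)
    qed
    ultimately show ?thesis
      using W_leI[OF N.prob_space_axioms T measurable_compose[OF fst g]] by simp
  qed
  show thesis
    by (rule that[of "distr (P \<Otimes>\<^sub>M U) borel T"]) (auto simp: N.prob_space_distr meas E_def intro: W)
qed

lemma W_infinity_le_of_ball:
  fixes \<mu> \<nu> :: "'a::polish_space measure" and x :: 'a
  assumes m: "\<mu> \<in> P_infinity" "\<nu> \<in> P_infinity" and b: "\<And>z. dist x z \<le> r"
  shows "W_infinity \<mu> \<nu> \<le> 2 * r"
proof (rule W_le_imp_W_infinity_le(1), rule W_le_distr_pair)
  show "AE p in \<mu> \<Otimes>\<^sub>M \<nu>. dist (fst p) (snd p) \<le> 2 * r"
  proof (rule AE_I2)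
    fix p :: "'a \<times> 'a"
    show "dist (fst p) (snd p) \<le> 2 * r"
      using dist_triangle3[of "fst p" "snd p" x] b[of "fst p"] b[of "snd p"] by simp
  qed
qed (use m P_infinityD in auto)

text \<open>The competitor \<open>\<rho>\<close> has an atom at \<open>y\<close> that is too heavy for the part of \<open>\<mu>\<close> within
  distance \<open>t\<close>, so it is far from \<open>\<mu>\<close>; but its atom only needs to be served from mass that lies
  within distance \<open>s < t\<close> of \<open>y\<close>, or from mass near \<open>x\<close> whose destination \<open>y\<close> sees with a gain.\<close>
lemma ex_competitor:
  fixes \<mu> :: "'a::polish_space measure"
  assumes m: "\<mu> \<in> P_infinity" and \<eta>: "0 < \<eta>" "\<eta> \<le> s" and s: "s < t" "t \<le> dist y x - \<eta>"
    and w: "0 < w" "w \<le> measure \<mu> (ball x \<eta>)"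
    and light: "measure \<mu> (cball y t) < measure \<mu> (cball y s) + w"
  shows "\<exists>\<rho>\<in>P_infinity. t \<le> W_infinity \<rho> \<mu> \<and>
    (\<forall>\<nu> \<pi> D r. \<pi> \<in> couplings \<mu> \<nu> \<longrightarrow> (AE p in \<pi>. dist (fst p) (snd p) \<le> r) \<longrightarrow> D \<in> sets borel \<longrightarrow> 0 \<le> r \<longrightarrow>
      w \<le> measure \<pi> (ball x \<eta> \<times> D) \<longrightarrow> (\<forall>z\<in>D. dist x z \<le> \<eta> + r \<longrightarrow> dist y z \<le> s + r) \<longrightarrow>
      W_le \<rho> \<nu> (s + r))"
proof -
  interpret prob_space \<mu> using P_infinityD m by blast
  note sm = P_infinityD(2)[OF m] and spm = P_infinityD(3)[OF m]
  let ?Q = "cball y s" and ?B = "ball x \<eta>"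
  \<comment> \<open>The radii satisfy s + \<eta> < t + \<eta> \<le> \<open>dist y x\<close>.\<close>
  have QB: "?Q \<inter> ?B = {}"
  proof -
    have False if "z \<in> ?Q" "z \<in> ?B" for z
      using that dist_triangle2[of y x z] s by simp
    then show ?thesis by blast
  qed
  have i: "(\<lambda>x. x) \<in> \<mu> \<rightarrow>\<^sub>M borel" using sm by (simp add: measurable_cong_sets[of \<mu> borel borel borel])
  \<comment> \<open>Taking C = B defines \<rho> from \<mu> alone, before any \<nu> or coupling is
    given.\<close>
  obtain \<rho> where \<rho>: "prob_space \<rho>" "sets \<rho> = sets borel"
    and meas: "\<And>A. A \<in> sets borel \<Longrightarrow> measure \<rho> A = measure \<mu> ((\<lambda>x. x) -` A \<inter> (space \<mu> - (?Q \<union> ?B)))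
      + (measure \<mu> ?Q + w) * indicator A y + (measure \<mu> ?B - w) * indicator A x"
    by (rule mass_relocation[OF prob_space_axioms i, of ?Q ?B ?B w y x]) (use sm QB w in auto)
  interpret r: prob_space \<rho> by fact
  have "\<rho> \<in> P_infinity"
  proof -
    obtain c R where R: "AE z in \<mu>. dist c z \<le> R" using m by (auto simp: P_infinity_iff)
    \<comment> \<open>The bound is enlarged to include the two new atoms x and y.\<close>
    define R' where "R' = max R (max (dist c x) (dist c y))"
    have A: "- cball c R' \<in> sets borel" by (intro borel_open open_Compl) simp
    let ?N = "(\<lambda>x. x) -` (- cball c R') \<inter> (space \<mu> - (?Q \<union> ?B))"
    have "?N \<in> sets \<mu>" using A sm spm by auto
    moreover have "AE z in \<mu>. z \<notin> ?N"
      using R by (rule eventually_mono) (auto simp: R'_def)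
    ultimately have "measure \<mu> ?N = 0"
      using AE_iff_null_sets measure_eq_0_null_sets by blast
    then have "measure \<rho> (- cball c R') = 0" using meas[OF A] by (simp add: R'_def)
    then have "- cball c R' \<in> null_sets \<rho>" using A \<rho>(2) by (auto simp: r.emeasure_eq_measure)
    from AE_not_in[OF this] have "AE z in \<rho>. dist c z \<le> R'" by simp
    then show ?thesis using \<rho> by (auto simp: P_infinity_iff)
  qed
  moreover have "t \<le> W_infinity \<rho> \<mu>"
  proof (rule ccontr)
    assume "\<not> ?thesis"
    \<comment> \<open>The whole atom at y would have to be matched inside the t-ball, whose mass is
      too small by \<open>light\<close>.\<close>
    then have "W_le \<rho> \<mu> t" by (intro W_infinity_less_W_le[OF \<open>\<rho> \<in> P_infinity\<close> m]) simp
    then have "measure \<rho> {y} \<le> measure \<mu> (cball y t)"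
      by (rule W_le_measure_le) auto
    moreover have "measure \<mu> ?Q + w \<le> measure \<rho> {y}"
      using meas[of "{y}"] w(2) by (simp add: indicator_def)
    ultimately show False using light by simp
  qed
  moreover have "W_le \<rho> \<nu> (s + r)"
    if \<pi>: "\<pi> \<in> couplings \<mu> \<nu>" "AE p in \<pi>. dist (fst p) (snd p) \<le> r" and D: "D \<in> sets borel" and r: "0 \<le> r"
      and wD: "w \<le> measure \<pi> (ball x \<eta> \<times> D)"
      and gain: "\<forall>z\<in>D. dist x z \<le> \<eta> + r \<longrightarrow> dist y z \<le> s + r" for \<nu> \<pi> D r
  proof -
    note C = couplingsD[OF \<pi>(1)]
    have setsI: "fst -` A \<in> sets \<pi>" "measure \<pi> (fst -` A) = measure \<mu> A" if "A \<in> sets borel" for A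
      using measurable_sets[OF C(6) that] measure_distr[OF C(6) that] C(3,4) by auto
    have setsD: "?B \<times> D \<in> sets \<pi>"
      unfolding C(2) borel_prod[symmetric] using D by (intro pair_measureI) auto
    have QB': "fst -` ?Q \<inter> fst -` ?B = {}" using QB by auto
    \<comment> \<open>The same relocation, now carried out on the space of the coupling and with the
      mass w taken only from pairs that end in D. The formula for the law does not involve C, so the
      result is again \<rho>.\<close>
    obtain \<rho>' where \<rho>': "prob_space \<rho>'" "sets \<rho>' = sets borel"
      and meas': "\<And>A. A \<in> sets borel \<Longrightarrow> measure \<rho>' A =
        measure \<pi> (fst -` A \<inter> (space \<pi> - (fst -` ?Q \<union> fst -` ?B)))
        + (measure \<pi> (fst -` ?Q) + w) * indicator A y + (measure \<pi> (fst -` ?B) - w) * indicator A x"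
      and W: "\<And>g r. g \<in> \<pi> \<rightarrow>\<^sub>M borel \<Longrightarrow> (AE \<omega> in \<pi>. (\<omega> \<in> fst -` ?Q \<union> ?B \<times> D \<longrightarrow> dist y (g \<omega>) \<le> r) \<and>
        (\<omega> \<in> fst -` ?B \<longrightarrow> dist x (g \<omega>) \<le> r) \<and>
        (\<omega> \<notin> fst -` ?Q \<union> fst -` ?B \<longrightarrow> dist (fst \<omega>) (g \<omega>) \<le> r)) \<Longrightarrow> W_le \<rho>' (distr \<pi> borel g) r"
      by (rule mass_relocation[OF C(1) C(6), of "fst -` ?Q" "fst -` ?B" "?B \<times> D" w y x])
        (use setsI setsD QB' w wD in auto)
    interpret r': prob_space \<rho>' by fact
    have "\<rho>' = \<rho>"
    proof (rule measure_eqI)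
      fix A assume "A \<in> sets \<rho>'"
      then have A: "A \<in> sets borel" using \<rho>' by simp
      have "fst -` A \<inter> (space \<pi> - (fst -` ?Q \<union> fst -` ?B)) = fst -` (A - (?Q \<union> ?B))"
        using C(3) by auto
      moreover have "(\<lambda>x. x) -` A \<inter> (space \<mu> - (?Q \<union> ?B)) = A - (?Q \<union> ?B)" using spm by auto
      ultimately have "measure \<rho>' A = measure \<rho> A"
        unfolding meas[OF A] meas'[OF A] using A by (simp add: setsI(2))
      then show "emeasure \<rho>' A = emeasure \<rho> A"
        by (simp add: r.emeasure_eq_measure r'.emeasure_eq_measure)
    qed (simp add: \<rho>(2) \<rho>'(2))
    have "W_le \<rho>' (distr \<pi> borel snd) (s + r)"
    \<comment> \<open>Mass sent to y comes from the s-ball or enjoys the gain on D; mass collapsed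
      to x travels at most \<eta> + r, which is within s + r as \<eta> \<le> s; the rest travels at
      most r.\<close>
    proof (rule W[OF C(7)])
      show "AE \<omega> in \<pi>. (\<omega> \<in> fst -` ?Q \<union> ?B \<times> D \<longrightarrow> dist y (snd \<omega>) \<le> s + r) \<and>
        (\<omega> \<in> fst -` ?B \<longrightarrow> dist x (snd \<omega>) \<le> s + r) \<and>
        (\<omega> \<notin> fst -` ?Q \<union> fst -` ?B \<longrightarrow> dist (fst \<omega>) (snd \<omega>) \<le> s + r)"
        using \<pi>(2)
      proof eventually_elim
        case (elim \<omega>)
        have x: "dist x (snd \<omega>) \<le> \<eta> + r" if "fst \<omega> \<in> ?B"
          using elim that dist_triangle[of x "snd \<omega>" "fst \<omega>"] by simp
        have "dist y (snd \<omega>) \<le> s + r" if "fst \<omega> \<in> ?Q"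
          using elim that dist_triangle[of y "snd \<omega>" "fst \<omega>"] by simp
        moreover have "dist y (snd \<omega>) \<le> s + r" if "\<omega> \<in> ?B \<times> D"
          using gain x that by (auto simp: mem_Times_iff)
        ultimately show ?case using x \<eta> elim by force
      qed
    qed
    then show ?thesis using \<open>\<rho>' = \<rho>\<close> C(5) by simp
  qed
  ultimately show ?thesis by blast
qed

section \<open>From the base space to the Wasserstein space: the gap at \<mu>\<close>

lemma P_infinity_gap:
  fixes \<mu> :: "'a::polish_space measure"
  assumes gc: "Metric_space.gromov_compactifiable (UNIV :: 'a set) dist"
    and m: "\<mu> \<in> P_infinity" and \<epsilon>: "\<epsilon> > 0"
  shows "\<exists>F \<delta>. finite F \<and> F \<subseteq> P_infinity \<and> \<delta> > 0 \<and>
    (\<forall>\<nu>\<in>P_infinity. \<epsilon> \<le> W_infinity \<mu> \<nu> \<longrightarrow> (\<exists>\<rho>\<in>F. W_infinity \<rho> \<nu> + \<delta> \<le> W_infinity \<rho> \<mu> + W_infinity \<mu> \<nu>))"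
proof -
  obtain x where x: "x \<in> measure_support \<mu>" using measure_support_nonempty[OF m] by blast
  show ?thesis
  proof (cases "\<exists>z1. \<epsilon>/3 \<le> dist x z1")
    case False
    \<comment> \<open>In a space this small no \<nu> has distance \<epsilon> from \<mu>, so the
      empty family satisfies the gap.\<close>
    then have "dist x z \<le> \<epsilon>/3" for z by (meson le_cases)
    then have "W_infinity \<mu> \<nu> < \<epsilon>" if "\<nu> \<in> P_infinity" for \<nu>
      using W_infinity_le_of_ball[OF m that, of x "\<epsilon>/3"] \<epsilon> by simp
    then show ?thesis by (intro exI[of _ "{}"] exI[of _ 1]) (auto simp: not_le)
  next
    case True
    then obtain z1 where z1: "\<epsilon>/3 \<le> dist x z1" by blast
    have "\<epsilon>/3 > 0" using \<epsilon> by simp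
    obtain F0 \<delta>0 where "finite F0 \<and> F0 \<subseteq> UNIV \<and> \<delta>0 > 0 \<and>
      (\<forall>z\<in>UNIV. \<epsilon>/3 \<le> dist x z \<longrightarrow> (\<exists>y\<in>F0. dist y z + \<delta>0 \<le> dist y x + dist x z))"
      using Metric_space.gromov_compactifiable_imp_gap[OF Met_TC.Metric_space_axioms gc UNIV_I[of x] \<open>\<epsilon>/3 > 0\<close>]
      by (elim exE) (rule that)
    then have F0: "finite F0" "\<delta>0 > 0"
      and gap0: "\<And>z. \<epsilon>/3 \<le> dist x z \<Longrightarrow> \<exists>y\<in>F0. dist y z + \<delta>0 \<le> dist y x + dist x z"
      by simp_all
    define \<delta> where "\<delta> = min \<delta>0 (\<epsilon>/3)"
    have \<delta>: "\<delta> > 0" "\<delta> \<le> \<delta>0" "\<delta> \<le> \<epsilon>/3" using F0 \<epsilon> by (auto simp: \<delta>_def)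
    \<comment> \<open>A y with 2 \<open>dist y x\<close> < \<delta> cannot show a gap, by the
      triangle inequality, and is discarded; this later keeps the radius s above \<eta>. The far
      point z1 takes care of the z near x.\<close>
    define F where "F = insert z1 {y \<in> F0. \<delta> \<le> 2 * dist y x}"
    have finF: "finite F" using F0 by (simp add: F_def)
    have DF: "\<delta> \<le> 2 * dist y x" if "y \<in> F" for y
      using that z1 \<delta> zero_le_dist[of x z1] by (auto simp: F_def dist_commute)
    \<comment> \<open>Points near x have no gap of their own. But transport is allowed over a
      distance r \<ge> \<epsilon>, so it is enough to beat the floor 2\<epsilon>/3, which z1 does
      for all z within \<epsilon>/3 of x.\<close>
    define D where "D y = {z. dist y z + \<delta> \<le> dist y x + max (dist x z) (2 * \<epsilon> / 3)}" for y
    have D: "D y \<in> sets borel" for y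
      unfolding D_def by (intro borel_closed closed_Collect_le continuous_intros)
    have cover: "\<exists>y\<in>F. z \<in> D y" for z
    proof (cases "\<epsilon>/3 \<le> dist x z")
      case True
      obtain y where y: "y \<in> F0" "dist y z + \<delta>0 \<le> dist y x + dist x z" using gap0[OF True] by blast
      then have "y \<in> F" using dist_triangle[of x z y] \<delta> by (simp add: F_def dist_commute)
      moreover have "z \<in> D y" using y(2) \<delta> by (auto simp: D_def)
      ultimately show ?thesis by blast
    next
      case False
      then have "z \<in> D z1" using dist_triangle[of z1 z x] \<delta> by (auto simp: D_def)
      then show ?thesis by (auto simp: F_def)
    qed
    define \<eta> where "\<eta> = \<delta>/8"
    have \<eta>: "\<eta> > 0" using \<delta> by (simp add: \<eta>_def)
    \<comment> \<open>The share of the mass near x that some y in F must receive by the pigeonhole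
      principle.\<close>
    define w where "w = measure \<mu> (ball x \<eta>) / card F"
    have cF: "card F > 0" using finF by (auto simp: F_def card_gt_0_iff)
    have w: "0 < w" "w \<le> measure \<mu> (ball x \<eta>)"
      using measure_ball_support_pos[OF m x \<eta>] cF by (auto simp: w_def field_simps)
    \<comment> \<open>The upper limit leaves room for \<eta> between the t-ball and x. The lower
      limit loses only \<delta>/4, so with the further loss \<eta> = \<delta>/8 the gain \<delta> on
      \<open>D y\<close> still brings \<open>dist y z\<close> below s + r.\<close>
    have "\<exists>s t. dist y x - \<delta>/4 < s \<and> s < t \<and> t < dist y x - \<delta>/8 \<and>
        measure \<mu> (cball y t) < measure \<mu> (cball y s) + w" for y
      by (rule ex_light_annulus[OF m _ w(1)]) (use \<delta> in simp)
    then obtain s t where st: "\<And>y. dist y x - \<delta>/4 < s y" "\<And>y. s y < t y" "\<And>y. t y < dist y x - \<delta>/8"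
      "\<And>y. measure \<mu> (cball y (t y)) < measure \<mu> (cball y (s y)) + w" by metis
    have \<eta>s: "\<eta> \<le> s y" if "y \<in> F" for y using st(1)[of y] DF[OF that] \<delta> by (simp add: \<eta>_def)
    define K where "K y \<rho> \<longleftrightarrow> (\<forall>\<nu> \<pi> D r. \<pi> \<in> couplings \<mu> \<nu> \<longrightarrow> (AE p in \<pi>. dist (fst p) (snd p) \<le> r) \<longrightarrow>
        D \<in> sets borel \<longrightarrow> 0 \<le> r \<longrightarrow> w \<le> measure \<pi> (ball x \<eta> \<times> D) \<longrightarrow>
        (\<forall>z\<in>D. dist x z \<le> \<eta> + r \<longrightarrow> dist y z \<le> s y + r) \<longrightarrow> W_le \<rho> \<nu> (s y + r))" for y \<rho>
    have "\<exists>\<rho>\<in>P_infinity. t y \<le> W_infinity \<rho> \<mu> \<and> K y \<rho>" if "y \<in> F" for y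
      unfolding K_def
      by (rule ex_competitor[OF m \<eta> \<eta>s[OF that] st(2) _ w st(4)]) (use st(3)[of y] in \<open>simp add: \<eta>_def\<close>)
    then obtain \<rho> where \<rho>: "\<And>y. y \<in> F \<Longrightarrow> \<rho> y \<in> P_infinity" "\<And>y. y \<in> F \<Longrightarrow> t y \<le> W_infinity (\<rho> y) \<mu>"
      "\<And>y. y \<in> F \<Longrightarrow> K y (\<rho> y)"
      by metis
    define \<gamma> where "\<gamma> = Min ((\<lambda>y. t y - s y) ` F)"
    have \<gamma>: "\<gamma> > 0" "\<And>y. y \<in> F \<Longrightarrow> \<gamma> \<le> t y - s y"
      using finF st(2) by (auto simp: \<gamma>_def F_def)
    have main: "\<exists>\<rho>'\<in>\<rho> ` F. W_infinity \<rho>' \<nu> + \<gamma>/2 \<le> W_infinity \<rho>' \<mu> + W_infinity \<mu> \<nu>"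
      if \<nu>: "\<nu> \<in> P_infinity" "\<epsilon> \<le> W_infinity \<mu> \<nu>" for \<nu>
    proof -
      \<comment> \<open>Half of the gain \<gamma> pays for a coupling that may fail to be optimal;
        the other half is the resulting gap.\<close>
      define r where "r = W_infinity \<mu> \<nu> + \<gamma>/2"
      have r: "\<epsilon> \<le> r" "0 \<le> r" using \<nu>(2) \<gamma>(1) \<epsilon> by (auto simp: r_def)
      have "W_le \<mu> \<nu> r" by (rule W_infinity_less_W_le[OF m \<nu>(1)]) (use \<gamma>(1) in \<open>simp add: r_def\<close>)
      then obtain \<pi> where \<pi>: "\<pi> \<in> couplings \<mu> \<nu>" "AE p in \<pi>. dist (fst p) (snd p) \<le> r"
        unfolding W_le_def by blast
      note C = couplingsD[OF \<pi>(1)]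
      interpret prob_space \<pi> by (rule C)
      \<comment> \<open>The sets \<open>D y\<close> cover the space, so if each received less than
        w, the mass leaving the ball around x would be less than \<open>card F\<close> times w,
        which is its actual mass.\<close>
      have "\<exists>y\<in>F. w \<le> measure \<pi> (ball x \<eta> \<times> D y)"
      proof (rule ccontr)
        assume n: "\<not> ?thesis"
        have "measure \<mu> (ball x \<eta>) = measure \<pi> (fst -` ball x \<eta>)"
          using measure_distr[OF C(6), of "ball x \<eta>"] C(3,4) by simp
        also have "fst -` ball x \<eta> = (\<Union>y\<in>F. ball x \<eta> \<times> D y)" using cover by auto
        also have "measure \<pi> \<dots> \<le> (\<Sum>y\<in>F. measure \<pi> (ball x \<eta> \<times> D y))"
        proof (rule finite_measure_subadditive_finite[OF finF])
          show "(\<lambda>y. ball x \<eta> \<times> D y) ` F \<subseteq> sets \<pi>"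
            unfolding C(2) borel_prod[symmetric] using D by (auto intro!: pair_measureI)
        qed
        also have "\<dots> < (\<Sum>y\<in>F. w)"
          by (rule sum_strict_mono) (use n finF in \<open>auto simp: F_def not_le\<close>)
        also have "\<dots> = measure \<mu> (ball x \<eta>)" using cF by (simp add: w_def)
        finally show False by simp
      qed
      then obtain y where y: "y \<in> F" "w \<le> measure \<pi> (ball x \<eta> \<times> D y)" by blast
      have "dist y z \<le> s y + r" if "z \<in> D y" "dist x z \<le> \<eta> + r" for z
      proof -
        have "dist y z + \<delta> \<le> dist y x + (\<eta> + r)" using that r \<eta> \<epsilon> by (auto simp: D_def)
        then show ?thesis using st(1)[of y] \<delta>(1) by (simp add: \<eta>_def)
      qed
      then have "W_le (\<rho> y) \<nu> (s y + r)" using \<rho>(3)[OF y(1)] \<pi> D r(2) y(2) unfolding K_def by blast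
      then have "W_infinity (\<rho> y) \<nu> \<le> s y + r" by (rule W_le_imp_W_infinity_le)
      then have "W_infinity (\<rho> y) \<nu> + \<gamma>/2 \<le> W_infinity (\<rho> y) \<mu> + W_infinity \<mu> \<nu>"
        using \<rho>(2)[OF y(1)] \<gamma>(2)[OF y(1)] by (simp add: r_def)
      then show ?thesis using y(1) by blast
    qed
    show ?thesis
      using finF \<rho>(1) \<gamma>(1) main by (intro exI[of _ "\<rho> ` F"] exI[of _ "\<gamma>/2"]) auto
  qed
qed

theorem theorem1p3:
  shows "Metric_space.gromov_compactifiable (P_infinity :: 'a::polish_space measure set) W_infinity
    \<longleftrightarrow> Metric_space.gromov_compactifiable (UNIV :: 'a set) dist"
proof
  assume gc: "Metric_space.gromov_compactifiable (UNIV :: 'a set) dist"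
  have "(P_infinity :: 'a measure set) \<noteq> {}"
    using return_in_P_infinity by blast
  then show "Metric_space.gromov_compactifiable (P_infinity :: 'a measure set) W_infinity"
    by (rule Metric_space.gap_imp_gromov_compactifiable[OF Metric_space_P_infinity])
      (rule P_infinity_gap[OF gc])
qed (rule gromov_compactifiable_of_P_infinity)

end
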